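(* Let $n\ge 2$ be an integer and let $G$ be the incidence graph of the complete graph $K_n$. Then $$\frac{3}{2}n\le h(G)\le \frac{5n+10}{3}.$$
   Context: A harmonious $k$-coloring of a finite simple graph $G$ is a proper vertex coloring with $k$ colors such that every (unordered) pair of colors appears on at most one edge. The harmonious chromatic number $h(G)$ is the minimum $k$ such that $G$ has a harmonious $k$-coloring. The incidence graph of $K_n$ is the bipartite graph with vertex set $V(K_n)\cup E(K_n)$ in which a vertex $x\in V(K_n)$ and an edge $e\in E(K_n)$ are adjacent if and only if $x$ is an endpoint of $e$. *)

theory Defs
  imports Complex_Main "HOL-Library.FuncSet"
begin

record 'a graph =
  verts :: "'a set"
  edges :: "'a set set"

definition finite_simple_graph :: "'a graph \<Rightarrow> bool" where
  "finite_simple_graph G \<longleftrightarrow>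
     finite (verts G) \<and> (\<forall>e\<in>edges G. e \<subseteq> verts G \<and> card e = 2)"

definition complete_graph :: "nat \<Rightarrow> nat graph" where
  "complete_graph n = \<lparr>verts = {..<n}, edges = {e. e \<subseteq> {..<n} \<and> card e = 2}\<rparr>"

definition incidence_graph :: "'a graph \<Rightarrow> ('a + 'a set) graph" where
  "incidence_graph G =
     \<lparr>verts = verts G <+> edges G,
      edges = {{Inl x, Inr e} | x e. x \<in> verts G \<and> e \<in> edges G \<and> x \<in> e}\<rparr>"

definition proper_coloring :: "'a graph \<Rightarrow> nat \<Rightarrow> ('a \<Rightarrow> nat) \<Rightarrow> bool" where
  "proper_coloring G k c \<longleftrightarrow>
     c \<in> verts G \<rightarrow> {..<k} \<and> (\<forall>u v. {u, v} \<in> edges G \<longrightarrow> c u \<noteq> c v)"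

(* The unordered pair of colors appearing on an edge e is the image c ` e. *)
definition harmonious_coloring :: "'a graph \<Rightarrow> nat \<Rightarrow> ('a \<Rightarrow> nat) \<Rightarrow> bool" where
  "harmonious_coloring G k c \<longleftrightarrow>
     proper_coloring G k c \<and> (\<forall>e\<in>edges G. \<forall>f\<in>edges G. c ` e = c ` f \<longrightarrow> e = f)"

(* The least element exists for every finite simple graph: see harmonious_coloring_exists. *)
definition harmonious_chromatic_number :: "'a graph \<Rightarrow> nat" where
  "harmonious_chromatic_number G = (LEAST k. \<exists>c. harmonious_coloring G k c)"

lemma finite_simple_graph_complete_graph: "finite_simple_graph (complete_graph n)"
  by (auto simp: finite_simple_graph_def complete_graph_def)

lemma finite_simple_graph_incidence_graph:
  assumes "finite_simple_graph G"
  shows "finite_simple_graph (incidence_graph G)"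
proof -
  have "edges G \<subseteq> Pow (verts G)" and "finite (verts G)"
    using assms by (auto simp: finite_simple_graph_def)
  then have "finite (edges G)"
    by (meson finite_Pow_iff finite_subset)
  with \<open>finite (verts G)\<close> show ?thesis
    by (auto simp: finite_simple_graph_def incidence_graph_def)
qed

lemma harmonious_coloring_exists:
  assumes "finite_simple_graph G"
  shows "\<exists>c. harmonious_coloring G (card (verts G)) c"
proof -
  have fin: "finite (verts G)" and sub: "\<And>e. e \<in> edges G \<Longrightarrow> e \<subseteq> verts G"
    and two: "\<And>e. e \<in> edges G \<Longrightarrow> card e = 2"
    using assms by (auto simp: finite_simple_graph_def)
  obtain c where c: "bij_betw c (verts G) {..<card (verts G)}"
    using ex_bij_betw_finite_nat[OF fin] by (auto simp: atLeast0LessThan)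
  then have inj: "inj_on c (verts G)" and "c \<in> verts G \<rightarrow> {..<card (verts G)}"
    by (auto simp: bij_betw_def)
  moreover have "c u \<noteq> c v" if "{u, v} \<in> edges G" for u v
  proof -
    have "u \<noteq> v" using two[OF that] by auto
    then show ?thesis using sub[OF that] inj by (auto dest: inj_onD)
  qed
  moreover have "e = f" if "e \<in> edges G" "f \<in> edges G" "c ` e = c ` f" for e f
    using that sub inj by (metis inj_on_image_eq_iff)
  ultimately show ?thesis
    unfolding harmonious_coloring_def proper_coloring_def by blast
qed

lemma harmonious_chromatic_number_attained:
  assumes "finite_simple_graph G"
  shows "\<exists>c. harmonious_coloring G (harmonious_chromatic_number G) c"
  unfolding harmonious_chromatic_number_def
  by (rule LeastI_ex) (use harmonious_coloring_exists[OF assms] in blast)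

end

theory Submission imports Defs "HOL-Number_Theory.Cong" begin

text \<open>
  A coloring of the incidence graph of the complete graph colors the vertices and the edges of the
  complete graph. Two vertices lie on a common edge, so they get distinct colors, and the edges at a
  vertex get pairwise distinct colors. Say that a vertex \<open>u\<close> sees a vertex \<open>u'\<close> if some edge at
  \<open>u\<close> has the color of \<open>u'\<close>. What remains of harmoniousness is that no vertex sees itself and
  no two vertices see each other.

  Lower bound. An edge with the color of a vertex is seen from both of its ends, and each of the
  $n(n-1)/2$ pairs of vertices is used by at most one such incidence. Hence at most half of all
  edges have the color of a vertex. The others are colored by the $k-n$ remaining colors, each of
  which occurs on a matching, that is, at most \<open>n div 2\<close> times. So
  $n(n-1)/4 \le (k-n) \lfloor n/2 \rfloor$, which gives $n \le 2(k-n)$ (lemma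
  \<open>three_halves_le_harmonious\<close>).

  Upper bound. Split the vertices into three parts of at most $m = \lceil n/3 \rceil$ vertices,
  arranged in a cycle. Color the edges inside a part by the vertices of the next part, as a cyclic
  addition table. Vertices then see only vertices of the next part, and in a cycle of three parts
  this relation is never mutual. The edges between the parts form a subgraph of $K_{m,m,m}$. Give the
  edge between positions $x$ and $y$ the sum $x + y$ modulo $m$. For $x \ne y$ the edges between
  these positions form a 6-cycle, which two colors per sum color properly, since different pairs of positions with the same sum are
  disjoint; for $x = y$ they form a
  triangle, and two colors suffice after the edge from the last part to the first is set aside. The
  edges set aside over all $x$ form a matching, so a single further color \<open>w\<close> serves them
  all. Thus $3m + 2m + 1$ colors are enough.

  This is small enough if 3 divides $n$. Otherwise the last position of the last part is vacant,
  and the color that its vertex would have is used only inside the second part. It can therefore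
  serve as \<open>w\<close>, and $5m$ colors are enough. Lemma \<open>harmonious_coloring_construction\<close>
  covers both choices of \<open>w\<close>.
\<close>

section \<open>Harmonious colorings of incidence graphs\<close>

text \<open>
  The edges of the incidence graph are the incidences \<open>x \<in> e\<close>, so harmoniousness becomes a
  condition on pairs of incidences.
\<close>

lemma harmonious_coloring_incidence_graph_iff:
  "harmonious_coloring (incidence_graph G) k c \<longleftrightarrow>
     (\<forall>x\<in>verts G. c (Inl x) < k) \<and> (\<forall>e\<in>edges G. c (Inr e) < k) \<and>
     (\<forall>x\<in>verts G. \<forall>e\<in>edges G. x \<in> e \<longrightarrow> c (Inl x) \<noteq> c (Inr e)) \<and>
     (\<forall>x\<in>verts G. \<forall>e\<in>edges G. \<forall>y\<in>verts G. \<forall>f\<in>edges G. x \<in> e \<longrightarrow> y \<in> f \<longrightarrow>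
        {c (Inl x), c (Inr e)} = {c (Inl y), c (Inr f)} \<longrightarrow> x = y \<and> e = f)"
  (is "?L \<longleftrightarrow> ?range \<and> ?range' \<and> ?proper \<and> ?inj")
proof -
  let ?H = "incidence_graph G"
  have range: "c \<in> verts ?H \<rightarrow> {..<k} \<longleftrightarrow> ?range \<and> ?range'"
    by (auto simp: incidence_graph_def Pi_def)
  have proper: "(\<forall>u v. {u, v} \<in> edges ?H \<longrightarrow> c u \<noteq> c v) \<longleftrightarrow> ?proper"
    by (fastforce simp: incidence_graph_def doubleton_eq_iff)
  have edges: "(\<forall>e\<in>edges ?H. P e) \<longleftrightarrow>
      (\<forall>x\<in>verts G. \<forall>e\<in>edges G. x \<in> e \<longrightarrow> P {Inl x, Inr e})" for P
    by (auto simp: incidence_graph_def)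
  have inj: "(\<forall>e\<in>edges ?H. \<forall>f\<in>edges ?H. c ` e = c ` f \<longrightarrow> e = f) \<longleftrightarrow> ?inj"
    unfolding edges by (simp add: doubleton_eq_iff)
  show ?thesis
    unfolding harmonious_coloring_def proper_coloring_def range proper inj by blast
qed

section \<open>The lower bound\<close>

lemma card_disjoint_pairs_le:
  assumes "finite V" "\<And>e. e \<in> F \<Longrightarrow> e \<subseteq> V \<and> card e = 2" "pairwise disjnt F"
  shows "card F \<le> card V div 2"
proof -
  have "finite F"
    using assms(1,2) by (meson PowI finite_Pow_iff finite_subset subsetI)
  have "card (\<Union>F) = (\<Sum>e\<in>F. card e)"
    using assms by (intro card_Union_disjoint) (auto intro: finite_subset)
  also have "\<dots> = 2 * card F"
    using assms(2) by simp
  finally have "2 * card F = card (\<Union>F)" ..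
  also have "\<dots> \<le> card V"
    using assms(1,2) by (intro card_mono) auto
  finally show ?thesis by simp
qed

lemma three_halves_le_harmonious:
  assumes "n \<ge> 2" and col: "harmonious_coloring (incidence_graph (complete_graph n)) k c"
  shows "3 * n \<le> 2 * k"
proof -
  define E where "E = {e. e \<subseteq> {..<n} \<and> card e = 2}"
  define a where "a i = c (Inl i)" for i
  define b where "b e = c (Inr e)" for e
  have a_less: "a i < k" if "i < n" for i
    using col that by (simp add: harmonious_coloring_incidence_graph_iff complete_graph_def a_def)
  have b_less: "b e < k" if "e \<in> E" for e
    using col that
    by (simp add: harmonious_coloring_incidence_graph_iff complete_graph_def b_def E_def)
  have proper: "a i \<noteq> b e" if "e \<in> E" "i \<in> e" for i e
  proof -
    have "i < n"
      using that by (auto simp: E_def)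
    with col that show ?thesis
      unfolding harmonious_coloring_incidence_graph_iff complete_graph_def a_def b_def E_def
      by simp
  qed
  have harm: "i = j \<and> e = f"
    if "e \<in> E" "i \<in> e" "f \<in> E" "j \<in> f" "{a i, b e} = {a j, b f}" for i j e f
  proof -
    have "i < n" "j < n"
      using that by (auto simp: E_def)
    with col that show ?thesis
      unfolding harmonious_coloring_incidence_graph_iff complete_graph_def a_def b_def E_def
      by simp
  qed
  have "finite E"
    unfolding E_def by (rule finite_subset[of _ "Pow {..<n}"]) auto
  have card_E: "card E = n choose 2"
    unfolding E_def using n_subsets[of "{..<n}" 2] by simp

  have inj_a: "inj_on a {..<n}"
  proof (rule inj_onI)
    fix i j assume ij: "i \<in> {..<n}" "j \<in> {..<n}" "a i = a j"
    show "i = j"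
    proof (rule ccontr)
      assume "i \<noteq> j"
      with ij have "{i, j} \<in> E" by (auto simp: E_def)
      with harm[of "{i, j}" i "{i, j}" j] ij \<open>i \<noteq> j\<close> show False by simp
    qed
  qed
  define S where "S = a ` {..<n}"
  have card_S: "card S = n" and "finite S" and "S \<subseteq> {..<k}"
    using inj_a a_less by (auto simp: S_def card_image)
  define E1 where "E1 = {e \<in> E. b e \<in> S}"
  define E2 where "E2 = {e \<in> E. b e \<notin> S}"
  have "finite E1" "finite E2"
    using \<open>finite E\<close> by (auto simp: E1_def E2_def)
  have "card E = card E1 + card E2"
    using \<open>finite E\<close> by (subst card_Un_disjoint[symmetric]) (auto simp: E1_def E2_def intro: arg_cong[of _ _ card])

  \<comment> \<open>Both incidences of an edge in \<open>E1\<close> take up a pair of vertex colors, and no pair is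
    taken up twice.\<close>
  have E1: "2 * card E1 \<le> n choose 2"
  proof -
    have "2 * card E1 = (\<Sum>e\<in>E1. card e)"
      by (simp add: E1_def E_def)
    also have "\<dots> = card (SIGMA e:E1. e)"
      using \<open>finite E1\<close> by (subst card_SigmaI) (auto simp: E1_def E_def intro: finite_subset)
    also have "\<dots> \<le> card {P. P \<subseteq> S \<and> card P = 2}"
    proof (rule card_inj_on_le)
      show "inj_on (\<lambda>(e, i). {a i, b e}) (SIGMA e:E1. e)"
      proof (rule inj_onI, clarify)
        fix e i f j assume "e \<in> E1" "i \<in> e" "f \<in> E1" "j \<in> f" "{a i, b e} = {a j, b f}"
        then show "e = f \<and> i = j"
          using harm[of e i f j] by (simp add: E1_def)
      qed
      show "(\<lambda>(e, i). {a i, b e}) ` (SIGMA e:E1. e) \<subseteq> {P. P \<subseteq> S \<and> card P = 2}"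
      proof clarify
        fix e i assume "e \<in> E1" "i \<in> e"
        then have "a i \<noteq> b e" "i < n" "b e \<in> S"
          using proper by (auto simp: E1_def E_def)
        then show "{a i, b e} \<subseteq> S \<and> card {a i, b e} = 2"
          by (auto simp: S_def)
      qed
      show "finite {P. P \<subseteq> S \<and> card P = 2}"
        using \<open>finite S\<close> by (rule_tac finite_subset[of _ "Pow S"]) auto
    qed
    also have "\<dots> = n choose 2"
      using n_subsets[OF \<open>finite S\<close>, of 2] card_S by simp
    finally show ?thesis .
  qed

  \<comment> \<open>Two edges with the same color cannot meet, so each other color occurs on a matching.\<close>
  have E2: "card E2 \<le> (k - n) * (n div 2)"
  proof -
    have fibre: "card {e \<in> E2. b e = t} \<le> n div 2" for t
    proof -
      have "pairwise disjnt {e \<in> E2. b e = t}"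
      proof (rule pairwiseI, rule ccontr)
        fix e f assume ef: "e \<in> {e \<in> E2. b e = t}" "f \<in> {e \<in> E2. b e = t}" "e \<noteq> f" "\<not> disjnt e f"
        then obtain i where "i \<in> e" "i \<in> f" by (auto simp: disjnt_def)
        with harm[of e i f i] ef show False by (simp add: E2_def)
      qed
      then show ?thesis
        using card_disjoint_pairs_le[of "{..<n}" "{e \<in> E2. b e = t}"] by (auto simp: E2_def E_def)
    qed
    have "card E2 = card (\<Union>t\<in>{..<k} - S. {e \<in> E2. b e = t})"
      using b_less by (intro arg_cong[of _ _ card]) (auto simp: E2_def)
    also have "\<dots> \<le> (\<Sum>t\<in>{..<k} - S. card {e \<in> E2. b e = t})"
      by (intro card_UN_le) simp
    also have "\<dots> \<le> (\<Sum>t\<in>{..<k} - S. n div 2)"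
      by (intro sum_mono fibre)
    also have "\<dots> = (k - n) * (n div 2)"
      using \<open>S \<subseteq> {..<k}\<close> \<open>finite S\<close> card_S by (simp add: card_Diff_subset)
    finally show ?thesis .
  qed

  have "n choose 2 \<le> 2 * ((k - n) * (n div 2))"
    using E1 E2 card_E \<open>card E = card E1 + card E2\<close> by linarith
  moreover have "even (n * (n - 1))"
    by (cases n) auto
  then have "2 * (n choose 2) = n * (n - 1)"
    by (simp add: choose_two)
  moreover define d where "d = k - n"
  ultimately have count: "n * (n - 1) \<le> 4 * d * (n div 2)"
    by (simp add: mult.assoc)
  \<comment> \<open>Rounding in \<open>n div 2\<close> gives the full bound \<open>n\<close> for odd \<open>n\<close>; for even \<open>n\<close> one gets
    only \<open>n - 1\<close>, and parity supplies the missing unit.\<close>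
  have "n \<le> 2 * d"
  proof (cases "even n")
    case True
    then obtain p where p: "n = 2 * p" by blast
    then have "p > 0" "p * (n - 1) \<le> p * (2 * d)"
      using count \<open>n \<ge> 2\<close> by auto
    then have "2 * p \<le> 2 * d + 1" using p by simp
    then have "p \<le> d" by linarith
    then show ?thesis using p by simp
  next
    case False
    then obtain p where p: "n = 2 * p + 1" by (auto elim: oddE)
    then have "p > 0" "(2 * p) * n \<le> (2 * p) * (2 * d)"
      using count \<open>n \<ge> 2\<close> by (auto simp: mult_ac)
    then show ?thesis by simp
  qed
  with \<open>n \<ge> 2\<close> show ?thesis
    unfolding d_def by linarith
qed

section \<open>The upper bound\<close>

text \<open>
  Vertices are numbers \<open>v\<close>, placed at position \<open>v div 3\<close> of part \<open>v mod 3\<close>. In this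
  order the position missing first, when the number of vertices is not a multiple of 3, is the last
  position of part 2.
\<close>

definition part :: "nat \<Rightarrow> nat" where
  "part v = v mod 3"

definition pos :: "nat \<Rightarrow> nat" where
  "pos v = v div 3"

definition next_part :: "nat \<Rightarrow> nat" where
  "next_part a = (if a = 2 then 0 else Suc a)"

text \<open>
  The color of an edge from \<open>u\<close> to a vertex \<open>v\<close> of the next part. The orientation determines the
  bit: around the 6-cycle on two positions, consecutive edges are directed alternately from the
  smaller to the larger position and back. The numbers from \<open>3 * m\<close> to \<open>5 * m - 1\<close> encode a sum
  modulo \<open>m\<close> together with a bit. In a triangle, the edges leaving parts 0 and 1 have the bits 0
  and 1, and the edge leaving part 2 has the color \<open>w\<close>.
\<close>

definition cross_color :: "nat \<Rightarrow> nat \<Rightarrow> nat \<Rightarrow> nat \<Rightarrow> nat" where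
  "cross_color m w u v =
     (if pos u = pos v \<and> part u = 2 then w
      else 3 * m + 2 * ((pos u + pos v) mod m) +
        (if pos u = pos v then part u else of_bool (pos u < pos v)))"

definition edge_color :: "nat \<Rightarrow> nat \<Rightarrow> nat \<Rightarrow> nat \<Rightarrow> nat" where
  "edge_color m w u v =
     (if part u = part v then 3 * ((pos u + pos v) mod m) + next_part (part u)
      else if part v = next_part (part u) then cross_color m w u v
      else cross_color m w v u)"

lemma part_cases:
  obtains "part u = 0" | "part u = 1" | "part u = 2"
proof -
  have "part u < 3" by (simp add: part_def)
  then show ?thesis using that by linarith
qed

lemma pos_less: "u < 3 * m \<Longrightarrow> pos u < m"
  by (simp add: pos_def less_mult_imp_div_less mult.commute)

lemma eq_of_pos_part: "pos u = pos v \<Longrightarrow> part u = part v \<Longrightarrow> u = v"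
  unfolding pos_def part_def by (metis mult_div_mod_eq)

lemma next_part_less: "next_part (part u) < 3"
  by (cases u rule: part_cases) (simp_all add: next_part_def)

lemma next_part_asym: "part v = next_part (part u) \<Longrightarrow> part u \<noteq> next_part (part v)"
  by (cases u rule: part_cases) (simp_all add: next_part_def)

lemma part_conv: "a < 3 \<Longrightarrow> part (3 * s + a) = a"
  by (simp add: part_def)

lemma next_part_cases:
  assumes "part u \<noteq> part v"
  obtains "part v = next_part (part u)" "part u \<noteq> next_part (part v)"
    | "part u = next_part (part v)" "part v \<noteq> next_part (part u)"
  using assms by (cases u rule: part_cases; cases v rule: part_cases) (simp_all add: next_part_def)

lemma edge_color_commute: "edge_color m w u v = edge_color m w v u"
proof (cases "part u = part v")
  case True
  then show ?thesis by (simp add: edge_color_def add.commute)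
next
  case False
  then show ?thesis
    by (cases rule: next_part_cases) (simp_all add: edge_color_def add.commute)
qed

lemma add_mod_cancel_left:
  assumes "(x + y) mod m = (x + z) mod m" "y < m" "z < (m::nat)"
  shows "y = z"
proof -
  have "[x + y = x + z] (mod m)"
    using assms(1) by (simp add: cong_def)
  then have "[y = z] (mod m)"
    by (simp add: cong_add_lcancel_nat)
  with assms show ?thesis
    by (simp add: cong_def)
qed

lemma inner_edge_color:
  assumes "part u = part v" "u < 3 * m"
  shows "edge_color m w u v < 3 * m" "part (edge_color m w u v) = next_part (part u)"
proof -
  have color: "edge_color m w u v = 3 * ((pos u + pos v) mod m) + next_part (part u)"
    using assms(1) by (simp add: edge_color_def)
  have "(pos u + pos v) mod m < m"
    using assms(2) by simp
  then show "edge_color m w u v < 3 * m"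
    unfolding color using next_part_less[of u] by linarith
  show "part (edge_color m w u v) = next_part (part u)"
    unfolding color using next_part_less by (rule part_conv)
qed

text \<open>
  The bit in the color of an edge between different parts, read from the end \<open>u\<close>: the first
  branch applies if the edge leaves \<open>u\<close> towards the next part, the second if it enters \<open>u\<close>.
\<close>

definition cross_bit :: "nat \<Rightarrow> nat \<Rightarrow> nat" where
  "cross_bit u v =
     (if part v = next_part (part u)
      then if pos u = pos v then part u else of_bool (pos u < pos v)
      else if pos u = pos v then part v else of_bool (pos v < pos u))"

text \<open>
  From \<open>u\<close> exactly two edges between parts lead to a given position, one leaving and one entering.
  Their sums agree, so the bit must tell them apart.
\<close>

lemma cross_bit_out_neq_in:
  assumes "part v = next_part (part u)" "part u = next_part (part v')" "pos v = pos v'"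
  shows "cross_bit u v \<noteq> cross_bit u v'"
  using assms by (cases v' rule: part_cases) (auto simp: cross_bit_def next_part_def)

lemma cross_edge_color_cases:
  assumes "part u \<noteq> part v"
  obtains (extra) "edge_color m w u v = w" "pos u = pos v"
      "part u = 2 \<and> part v = 0 \<or> part u = 0 \<and> part v = 2"
    | (fresh) "edge_color m w u v = 3 * m + 2 * ((pos u + pos v) mod m) + cross_bit u v"
      "cross_bit u v < 2"
proof -
  have "(edge_color m w u v = w \<and> pos u = pos v \<and>
        (part u = 2 \<and> part v = 0 \<or> part u = 0 \<and> part v = 2)) \<or>
      (edge_color m w u v = 3 * m + 2 * ((pos u + pos v) mod m) + cross_bit u v \<and>
        cross_bit u v < 2)"
    using assms
    by (cases u rule: part_cases; cases v rule: part_cases)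
      (simp_all add: edge_color_def cross_color_def cross_bit_def next_part_def add.commute)
  with extra fresh show ?thesis by blast
qed

lemma edge_color_range:
  assumes "u < 3 * m"
  shows "edge_color m w u v < 5 * m \<or> edge_color m w u v = w"
proof (cases "part u = part v")
  case True
  then show ?thesis using inner_edge_color(1)[OF True assms, of w] by linarith
next
  case False
  then show ?thesis
  proof (cases rule: cross_edge_color_cases[of u v m w])
    case fresh
    have "(pos u + pos v) mod m < m"
      using assms by simp
    with fresh show ?thesis by linarith
  qed simp
qed

text \<open>
  Only edges inside a part carry the colors of vertices that are present, since \<open>w\<close> is not among
  these. So a vertex sees only vertices of the next part.
\<close>

lemma part_edge_color_vertex:
  assumes "edge_color m w u v < n" "u < n" "n \<le> 3 * m" "n \<le> w"
  shows "part (edge_color m w u v) = next_part (part u)"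
proof (cases "part u = part v")
  case True
  then show ?thesis using inner_edge_color(2) assms by simp
next
  case False
  then show ?thesis
    using assms by (cases rule: cross_edge_color_cases[of u v m w]) auto
qed

text \<open>
  If \<open>w\<close> is the number of a vertex of part 2, it also occurs inside part 1. The edges between
  parts with color \<open>w\<close> avoid part 1, as they join parts 2 and 0.
\<close>

lemma inner_edge_color_neq_cross:
  assumes inner: "part u = part v" and cross: "part u \<noteq> part v'" and "u < 3 * m"
    and w: "5 * m \<le> w \<or> w < 3 * m \<and> part w = 2"
  shows "edge_color m w u v \<noteq> edge_color m w u v'"
  using cross
proof (cases rule: cross_edge_color_cases[of u v' m w])
  case extra
  then have "next_part (part u) \<noteq> 2"
    by (auto simp: next_part_def)
  with extra inner_edge_color[OF inner \<open>u < 3 * m\<close>, of w] w show ?thesis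
    by auto
next
  case fresh
  with inner_edge_color(1)[OF inner \<open>u < 3 * m\<close>, of w] show ?thesis by simp
qed

text \<open>
  An edge with color \<open>w\<close> joins equal positions of parts 2 and 0, so \<open>u\<close> has at most one such
  edge. From any other color one recovers the sum of the positions, hence the position of \<open>v\<close>,
  and then the part of \<open>v\<close> from the bit.
\<close>

lemma cross_edge_color_inj:
  assumes cross: "part u \<noteq> part v" "part u \<noteq> part v'"
    and less: "u < 3 * m" "v < 3 * m" "v' < 3 * m"
    and w: "5 * m \<le> w \<or> w < 3 * m"
    and eq: "edge_color m w u v = edge_color m w u v'"
  shows "v = v'"
proof -
  have fresh_neq_w: "3 * m + 2 * ((pos u + y) mod m) + b \<noteq> w" if "b < 2" for y b
  proof -
    have "(pos u + y) mod m < m"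
      using less by simp
    with that w show ?thesis by linarith
  qed
  show ?thesis
    using cross(1)
  proof (cases rule: cross_edge_color_cases[of u v m w])
    case v: extra
    show ?thesis
      using cross(2)
    proof (cases rule: cross_edge_color_cases[of u v' m w])
      case extra
      have "pos v = pos v'"
        using v(2) extra(2) by simp
      moreover have "part v = part v'"
        using v(3) extra(3) by linarith
      ultimately show ?thesis
        by (rule eq_of_pos_part)
    next
      case fresh
      then show ?thesis
        using fresh_neq_w[OF fresh(2), of "pos v'"] v(1) eq by metis
    qed
  next
    case v: fresh
    show ?thesis
      using cross(2)
    proof (cases rule: cross_edge_color_cases[of u v' m w])
      case extra
      then show ?thesis
        using fresh_neq_w[OF v(2), of "pos v"] v(1) eq by metis
    next
      case v': fresh
      define s where "s = (pos u + pos v) mod m"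
      define s' where "s' = (pos u + pos v') mod m"
      have "2 * s + cross_bit u v = 2 * s' + cross_bit u v'"
        using v v' eq by (simp add: s_def s'_def)
      with v(2) v'(2) have "s = s'" and bit: "cross_bit u v = cross_bit u v'"
        by presburger+
      have pos: "pos v = pos v'"
        using \<open>s = s'\<close> unfolding s_def s'_def
        by (rule add_mod_cancel_left) (use less pos_less in auto)
      moreover have "part v = part v'"
        using cross_bit_out_neq_in[of v u v'] cross_bit_out_neq_in[of v' u v] bit pos cross
        by (cases u rule: part_cases; cases v rule: part_cases; cases v' rule: part_cases)
          (simp_all add: next_part_def)
      ultimately show ?thesis
        by (rule eq_of_pos_part)
    qed
  qed
qed

lemma edge_color_inj:
  assumes less: "u < 3 * m" "v < 3 * m" "v' < 3 * m"
    and w: "5 * m \<le> w \<or> w < 3 * m \<and> part w = 2"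
    and eq: "edge_color m w u v = edge_color m w u v'"
  shows "v = v'"
proof (cases "part u = part v"; cases "part u = part v'")
  assume inner: "part u = part v" "part u = part v'"
  then have "(pos u + pos v) mod m = (pos u + pos v') mod m"
    using eq by (simp add: edge_color_def)
  then have "pos v = pos v'"
    by (rule add_mod_cancel_left) (use less pos_less in auto)
  then show ?thesis
    by (rule eq_of_pos_part) (use inner in simp)
next
  assume "part u = part v" "part u \<noteq> part v'"
  then show ?thesis
    using inner_edge_color_neq_cross[of u v v' m w] less w eq by blast
next
  assume "part u \<noteq> part v" "part u = part v'"
  then show ?thesis
    using inner_edge_color_neq_cross[of u v' v m w] less w eq by metis
next
  assume "part u \<noteq> part v" "part u \<noteq> part v'"
  then show ?thesis
    using cross_edge_color_inj[of u v v' m w] less w eq by blast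
qed

text \<open>
  The second alternative for \<open>w\<close> is a vertex number in part 2 that no vertex uses, because
  \<open>n \<le> w\<close>.
\<close>

lemma harmonious_coloring_construction:
  assumes n: "n \<le> 3 * m" "n \<le> w" and k: "5 * m \<le> k" "w < k"
    and w: "5 * m \<le> w \<or> w < 3 * m \<and> part w = 2"
  shows "\<exists>c. harmonious_coloring (incidence_graph (complete_graph n)) k c"
proof -
  define c :: "nat + nat set \<Rightarrow> nat"
    where "c = case_sum id (\<lambda>e. edge_color m w (Min e) (Max e))"
  have c_vertex: "c (Inl u) = u" for u
    by (simp add: c_def)
  have c_edge: "c (Inr {u, v}) = edge_color m w u v" for u v
    by (cases "u \<le> v") (simp_all add: c_def max_def min_def edge_color_commute)
  have vertex: "u < n" if "u \<in> verts (complete_graph n)" for u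
    using that by (simp add: complete_graph_def)
  have other_end: "\<exists>v. e = {u, v} \<and> u < n \<and> v < n"
    if "e \<in> edges (complete_graph n)" "u \<in> e" for u e
    using that by (auto simp: complete_graph_def card_2_iff)
  have vertex_class: "part (edge_color m w u v) = next_part (part u)"
    if "edge_color m w u v < n" "u < n" for u v
    using part_edge_color_vertex[OF that n] .
  show ?thesis
  proof (intro exI[of _ c], unfold harmonious_coloring_incidence_graph_iff, intro conjI ballI impI)
    fix u assume "u \<in> verts (complete_graph n)"
    then show "c (Inl u) < k"
      using vertex[of u] n k by (simp add: c_vertex)
  next
    fix e assume e: "e \<in> edges (complete_graph n)"
    then obtain u where "u \<in> e"
      by (auto simp: complete_graph_def card_2_iff)
    with other_end[OF e] obtain v where "e = {u, v}" "u < n"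
      by blast
    then show "c (Inr e) < k"
      using edge_color_range[of u m w v] n k by (auto simp: c_edge)
  next
    fix u e assume "e \<in> edges (complete_graph n)" "u \<in> e"
    with other_end obtain v where e: "e = {u, v}" "u < n"
      by blast
    show "c (Inl u) \<noteq> c (Inr e)"
    proof
      assume "c (Inl u) = c (Inr e)"
      with e have "edge_color m w u v = u"
        by (simp add: c_vertex c_edge)
      with vertex_class[of u v] e have "part u = next_part (part u)"
        by simp
      then show False
        by (cases u rule: part_cases) (simp_all add: next_part_def)
    qed
  next
    fix u e u' e'
    assume ends: "e \<in> edges (complete_graph n)" "u \<in> e" "e' \<in> edges (complete_graph n)" "u' \<in> e'"
      and pairs: "{c (Inl u), c (Inr e)} = {c (Inl u'), c (Inr e')}"
    obtain v v' where e: "e = {u, v}" "e' = {u', v'}"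
      and less: "u < n" "v < n" "u' < n" "v' < n"
      using other_end[OF ends(1,2)] other_end[OF ends(3,4)] by blast
    have "u = u' \<and> edge_color m w u v = edge_color m w u' v' \<or>
        edge_color m w u' v' = u \<and> edge_color m w u v = u'"
      using pairs unfolding e c_vertex c_edge doubleton_eq_iff by argo
    then have "u = u' \<and> e = e'"
    proof
      assume same: "u = u' \<and> edge_color m w u v = edge_color m w u' v'"
      then have "edge_color m w u v = edge_color m w u v'"
        by metis
      then have "v = v'"
        by (rule edge_color_inj[rotated -1]) (use less n w in auto)
      with same show ?thesis
        by (simp add: e)
    next
      assume "edge_color m w u' v' = u \<and> edge_color m w u v = u'"
      then have "part u' = next_part (part u)" "part u = next_part (part u')"
        using vertex_class[of u v] vertex_class[of u' v'] less by metis+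
      then show ?thesis
        using next_part_asym by blast
    qed
    then show "u = u'" "e = e'"
      by simp_all
  qed
qed

lemma ex_harmonious_coloring_le_five_thirds:
  "\<exists>k c. 3 * k \<le> 5 * n + 10 \<and> harmonious_coloring (incidence_graph (complete_graph n)) k c"
proof (cases "3 dvd n")
  case True
  then obtain m where "n = 3 * m" by blast
  then have "\<exists>c. harmonious_coloring (incidence_graph (complete_graph n)) (5 * m + 1) c"
    by (intro harmonious_coloring_construction[of n m "5 * m"]) auto
  moreover have "3 * (5 * m + 1) \<le> 5 * n + 10"
    using \<open>n = 3 * m\<close> by simp
  ultimately show ?thesis by blast
next
  case False
  define m where "m = n div 3 + 1"
  have n: "n \<le> 3 * m - 1" "3 * m \<le> n + 2" and "m > 0"
    using False unfolding m_def by presburger+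
  have "3 * m - 1 = 3 * (n div 3) + 2"
    by (simp add: m_def)
  then have "part (3 * m - 1) = 2"
    using part_conv[of 2] by simp
  then have "\<exists>c. harmonious_coloring (incidence_graph (complete_graph n)) (5 * m) c"
    using n(1) \<open>m > 0\<close> by (intro harmonious_coloring_construction[of n m "3 * m - 1"]) simp_all
  moreover have "3 * (5 * m) \<le> 5 * n + 10"
    using n(2) by simp
  ultimately show ?thesis by blast
qed

section \<open>The harmonious chromatic number\<close>

theorem theorem11:
  fixes n :: nat and G :: "(nat + nat set) graph"
  assumes "n \<ge> 2" and "G = incidence_graph (complete_graph n)"
  shows "3 / 2 * real n \<le> real (harmonious_chromatic_number G) \<and>
    real (harmonious_chromatic_number G) \<le> (5 * real n + 10) / 3"
proof
  obtain c where "harmonious_coloring G (harmonious_chromatic_number G) c"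
    using harmonious_chromatic_number_attained finite_simple_graph_incidence_graph
      finite_simple_graph_complete_graph assms(2) by metis
  then have "3 * n \<le> 2 * harmonious_chromatic_number G"
    using three_halves_le_harmonious assms by metis
  then have "3 * real n \<le> 2 * real (harmonious_chromatic_number G)"
    by linarith
  then show "3 / 2 * real n \<le> real (harmonious_chromatic_number G)"
    by simp
next
  obtain k c where k: "3 * k \<le> 5 * n + 10" and "harmonious_coloring G k c"
    using ex_harmonious_coloring_le_five_thirds assms(2) by metis
  then have "harmonious_chromatic_number G \<le> k"
    unfolding harmonious_chromatic_number_def by (intro Least_le) blast
  with k have "3 * real (harmonious_chromatic_number G) \<le> 5 * real n + 10"
    by linarith
  then show "real (harmonious_chromatic_number G) \<le> (5 * real n + 10) / 3"
    by simp
qed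

end
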